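(* Let $S=[5]$, $T=[3]$, $$E_1=\{(1,1),(1,2),(2,1),(2,3),(3,2),(3,3),(4,1),(5,2)\},\qquad E_2=\{(2,2;3,1),\ (4,2;5,3)\},$$ and $G=(S,T,E_1\cup E_2)$. Then the associated doubly simple biquadratic form $$P_G(\mathbf{x},\mathbf{y})=\sum_{(i,j)\in E_1}x_i^2y_j^2+(x_2y_2+x_3y_1)^2+(x_4y_2+x_5y_3)^2$$ satisfies $\mathrm{SOS}(P_G)\le 9<10=|E_1|+|E_2|$. Hence this $5\times 3$ example is not irreducible. In particular, the local prohibition (W2') cannot be removed entirely: it is not true that every augmented bipartite graph satisfying (S), (W1), (W2) and (W3) has an irreducible associated form.
   Context: Notation: $[m]=\{1,\dots,m\}$. For an $m\times n$ biquadratic form $P(\mathbf{x},\mathbf{y})$ that is a finite sum of squares of real bilinear forms in $(\mathbf{x},\mathbf{y})$, $\mathrm{SOS}(P)$ (the SOS rank, also written $\operatorname{sos}(P)$) is the minimum number of squares in such a representation. Augmented bipartite graphs $G=(S,T,E_1\cup E_2)$, $S=[m]$, $T=[n]$. A cell is a pair $(i,j)\in[m]\times[n]$ ($i$ is its row, $j$ its column). A 1-edge is a cell; $E_1$ is a set of 1-edges, viewed as a bipartite graph $G_1$ on $S,T$. A 2-edge is an unordered pair of distinct cells, written $(i,j;k,l)$; the cells $(i,j)$ and $(k,l)$ are its two halves. It is nondegenerate if $i\ne k$ and $j\ne l$, row-degenerate if $i=k$ and $j\neq l$, column-degenerate if $i\ne k$ and $j=l$. $E_2$ is a set of 2-edges.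 The associated doubly simple biquadratic form is $P_G=\sum_{(i,j)\in E_1}x_i^2y_j^2+\sum_{(i,j;k,l)\in E_2}(x_iy_j+x_ky_l)^2$; it is called irreducible if $\mathrm{SOS}(P_G)=|E_1|+|E_2|$. A cell is occupied if it is in $E_1$ or is a half of some 2-edge in $E_2$; otherwise it is unoccupied. The opposite cells of a nondegenerate 2-edge $(i,j;k,l)$ are $(i,l)$ and $(k,j)$. Two nondegenerate 2-edges of the form $(i,j;k,l)$ and $(i,l;k,j)$ are called complementary. The dependency graph $\mathcal{D}$ is the directed graph whose vertices are the nondegenerate 2-edges in $E_2$, with an arc $e\to e'$ ($e\ne e'$) if both opposite cells of $e$ are occupied and one half of $e'$ is an opposite cell of $e$. An edge's row (column) set is the set of rows (columns) of its cell (1-edge) or of its halves (2-edge). Two edges are vertex-disjoint if their row sets are disjoint and their column sets are disjoint. The opposite cells of a vertex-disjoint pair $e,f$ are the cells formed by a row of one of the two edges and a column of the other. For a 1-edge $(i,j)$ and a 2-edge $(k,l;p,q)$ they are $(i,l),(i,q),(k,j),(p,j)$. Conditions: (S) No 2-edge shares a cell with any 1-edge or with any other 2-edge. (W1) $G_1$ contains no $C_4$. (W2) $\mathcal{D}$ contains no directed cycle other than 2-cycles formed by a pair of complementary 2-edges (which are allowed). (W2') There is no nondegenerate 2-edge in $E_2$ whose two opposite cells are both 1-edges. (W3) For every vertex-disjoint pair of edges of $G$ at least one of which is a 2-edge, at least one of the opposite cells of the pair is unoccupied. *)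

theory Defs
  imports Complex_Main "Graph_Theory.Arc_Walk"
begin

section \<open>Biquadratic forms and the SOS rank\<close>

text \<open>
  Real forms in \<open>x = (x\<^sub>1, \<dots>, x\<^sub>m)\<close> and \<open>y = (y\<^sub>1, \<dots>, y\<^sub>n)\<close> are represented by their polynomial
  functions. Vectors are total functions on \<^typ>\<open>nat\<close> of which only the coordinates
  \<open>{1..m}\<close> and \<open>{1..n}\<close> matter, so that \<open>m\<close> and \<open>n\<close> may vary inside a statement.
\<close>

type_synonym form = "(nat \<Rightarrow> real) \<Rightarrow> (nat \<Rightarrow> real) \<Rightarrow> real"

definition bilinear_form :: "nat \<Rightarrow> nat \<Rightarrow> form \<Rightarrow> bool" where
  "bilinear_form m n B \<longleftrightarrow>
     (\<exists>b :: nat \<Rightarrow> nat \<Rightarrow> real. \<forall>x y. B x y = (\<Sum>i\<in>{1..m}. \<Sum>j\<in>{1..n}. b i j * x i * y j))"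

definition sum_of_bilinear_squares :: "nat \<Rightarrow> nat \<Rightarrow> form \<Rightarrow> nat \<Rightarrow> bool" where
  "sum_of_bilinear_squares m n P r \<longleftrightarrow>
     (\<exists>B :: nat \<Rightarrow> form. (\<forall>t<r. bilinear_form m n (B t)) \<and>
        (\<forall>x y. P x y = (\<Sum>t<r. (B t x y)\<^sup>2)))"

text \<open>Only meaningful if \<open>P\<close> is a sum of squares of bilinear forms; no value is prescribed otherwise.\<close>

definition sos_rank :: "nat \<Rightarrow> nat \<Rightarrow> form \<Rightarrow> nat" where
  "sos_rank m n P = (LEAST r. sum_of_bilinear_squares m n P r)"

section \<open>Augmented bipartite graphs\<close>

text \<open>
  A cell \<open>(i, j)\<close> is a pair of a row and a column. The 2-edge \<open>(i, j; k, l)\<close> is the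
  two-element set \<open>{(i, j), (k, l)}\<close> of its halves. The graph with vertex sets \<open>{1..m}\<close>, \<open>{1..n}\<close>
  and edges \<open>E1 \<union> E2\<close> is given by its four components.
\<close>

type_synonym cell = "nat \<times> nat"

definition augmented_bipartite_graph :: "nat \<Rightarrow> nat \<Rightarrow> cell set \<Rightarrow> cell set set \<Rightarrow> bool" where
  "augmented_bipartite_graph m n E1 E2 \<longleftrightarrow>
     E1 \<subseteq> {1..m} \<times> {1..n} \<and> (\<forall>e\<in>E2. e \<subseteq> {1..m} \<times> {1..n} \<and> card e = 2)"

definition assoc_form :: "cell set \<Rightarrow> cell set set \<Rightarrow> form" where
  "assoc_form E1 E2 x y =
     (\<Sum>(i, j)\<in>E1. (x i)\<^sup>2 * (y j)\<^sup>2) + (\<Sum>e\<in>E2. (\<Sum>(i, j)\<in>e. x i * y j)\<^sup>2)"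

definition irreducible_graph :: "nat \<Rightarrow> nat \<Rightarrow> cell set \<Rightarrow> cell set set \<Rightarrow> bool" where
  "irreducible_graph m n E1 E2 \<longleftrightarrow> sos_rank m n (assoc_form E1 E2) = card E1 + card E2"

definition occupied :: "cell set \<Rightarrow> cell set set \<Rightarrow> cell set" where
  "occupied E1 E2 = E1 \<union> \<Union>E2"

definition nondegenerate :: "cell set \<Rightarrow> bool" where
  "nondegenerate e \<longleftrightarrow> (\<exists>i j k l. e = {(i, j), (k, l)} \<and> i \<noteq> k \<and> j \<noteq> l)"

text \<open>For \<open>e = {(i, j), (k, l)}\<close> with \<open>i \<noteq> k\<close> and \<open>j \<noteq> l\<close> these are \<open>(i, l)\<close> and \<open>(k, j)\<close>.\<close>

definition opposite_cells :: "cell set \<Rightarrow> cell set" where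
  "opposite_cells e = {(i, l) | i j k l. (i, j) \<in> e \<and> (k, l) \<in> e \<and> (i, j) \<noteq> (k, l)}"

definition complementary :: "cell set \<Rightarrow> cell set \<Rightarrow> bool" where
  "complementary e f \<longleftrightarrow>
     (\<exists>i j k l. i \<noteq> k \<and> j \<noteq> l \<and> e = {(i, j), (k, l)} \<and> f = {(i, l), (k, j)})"

definition dependency_graph ::
    "cell set \<Rightarrow> cell set set \<Rightarrow> (cell set, cell set \<times> cell set) pre_digraph" where
  "dependency_graph E1 E2 =
     \<lparr> verts = {e \<in> E2. nondegenerate e},
       arcs = {(e, f). e \<in> E2 \<and> nondegenerate e \<and> f \<in> E2 \<and> nondegenerate f \<and> e \<noteq> f \<and>
                 opposite_cells e \<subseteq> occupied E1 E2 \<and> f \<inter> opposite_cells e \<noteq> {}},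
       tail = fst, head = snd \<rparr>"

text \<open>
  The following three notions apply to edges given as sets of cells, a 1-edge \<open>c\<close> being the
  singleton \<open>{c}\<close>; the images under \<^const>\<open>fst\<close> and \<^const>\<open>snd\<close> are the row and the column set.
\<close>

definition edges :: "cell set \<Rightarrow> cell set set \<Rightarrow> cell set set" where
  "edges E1 E2 = (\<lambda>c. {c}) ` E1 \<union> E2"

definition vertex_disjoint :: "cell set \<Rightarrow> cell set \<Rightarrow> bool" where
  "vertex_disjoint e f \<longleftrightarrow> fst ` e \<inter> fst ` f = {} \<and> snd ` e \<inter> snd ` f = {}"

definition pair_opposite_cells :: "cell set \<Rightarrow> cell set \<Rightarrow> cell set" where
  "pair_opposite_cells e f = fst ` e \<times> snd ` f \<union> fst ` f \<times> snd ` e"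

section \<open>The conditions\<close>

definition cond_S :: "cell set \<Rightarrow> cell set set \<Rightarrow> bool" where
  "cond_S E1 E2 \<longleftrightarrow> (\<forall>e\<in>E2. e \<inter> E1 = {} \<and> (\<forall>f\<in>E2. f \<noteq> e \<longrightarrow> e \<inter> f = {}))"

text \<open>A \<open>C\<^sub>4\<close> of a bipartite graph consists of all four edges between two rows and two columns.\<close>

definition cond_W1 :: "cell set \<Rightarrow> bool" where
  "cond_W1 E1 \<longleftrightarrow>
     \<not> (\<exists>i k j l. i \<noteq> k \<and> j \<noteq> l \<and> {(i, j), (i, l), (k, j), (k, l)} \<subseteq> E1)"

definition cond_W2 :: "cell set \<Rightarrow> cell set set \<Rightarrow> bool" where
  "cond_W2 E1 E2 \<longleftrightarrow>
     (\<forall>p. pre_digraph.cycle (dependency_graph E1 E2) p \<longrightarrow>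
        (\<exists>e f. p = [(e, f), (f, e)] \<and> complementary e f))"

definition cond_W2' :: "cell set \<Rightarrow> cell set set \<Rightarrow> bool" where
  "cond_W2' E1 E2 \<longleftrightarrow> \<not> (\<exists>e\<in>E2. nondegenerate e \<and> opposite_cells e \<subseteq> E1)"

text \<open>By symmetry, the 2-edge required in the pair may be taken to be the first edge.\<close>

definition cond_W3 :: "cell set \<Rightarrow> cell set set \<Rightarrow> bool" where
  "cond_W3 E1 E2 \<longleftrightarrow>
     (\<forall>e\<in>E2. \<forall>f\<in>edges E1 E2. vertex_disjoint e f \<longrightarrow>
        (\<exists>c\<in>pair_opposite_cells e f. c \<notin> occupied E1 E2))"

end

(*
  Both opposite cells of the 2-edge (2,2;3,1) are 1-edges, so half of its mixed term
  2 x2 y2 x3 y1 = 2 x2 y1 x3 y2 may be moved to the other diagonal of the rectangle. With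
  s^2 = 3/4, the remaining weight of x2^2 y2^2 and x3^2 y2^2 is absorbed by the 1-edges
  (2,3) and (3,3), and the five squares supported on rows 2 and 3 become the four squares
    (x2 y1 + x3 y2 / 2)^2 + (x3 y1 + x2 y2 / 2)^2
      + (x2 y3 - s x3 y2)^2 + (x3 y3 + s x2 y2)^2.
*)
theory Submission
  imports Defs
begin

lemma bilinear_form_monomial:
  assumes "i \<in> {1..m}" "j \<in> {1..n}"
  shows "bilinear_form m n (\<lambda>x y. x i * y j)"
  unfolding bilinear_form_def
proof (intro exI allI)
  fix x y :: "nat \<Rightarrow> real"
  have "(\<Sum>k\<in>{1..m}. \<Sum>l\<in>{1..n}. of_bool (k = i \<and> l = j) * x k * y l)
      = (\<Sum>k\<in>{1..m}. if k = i then (\<Sum>l\<in>{1..n}. if l = j then x k * y l else 0) else 0)"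
    by (intro sum.cong refl)
      (auto simp: of_bool_def if_distrib[of "\<lambda>c. c * _"] cong: if_cong)
  also have "\<dots> = x i * y j"
    using assms by simp
  finally show "x i * y j = (\<Sum>k\<in>{1..m}. \<Sum>l\<in>{1..n}. of_bool (k = i \<and> l = j) * x k * y l)" ..
qed

lemma bilinear_form_add:
  assumes "bilinear_form m n B" "bilinear_form m n C"
  shows "bilinear_form m n (\<lambda>x y. B x y + C x y)"
proof -
  obtain b c :: "nat \<Rightarrow> nat \<Rightarrow> real"
    where b: "\<And>x y. B x y = (\<Sum>i\<in>{1..m}. \<Sum>j\<in>{1..n}. b i j * x i * y j)"
      and c: "\<And>x y. C x y = (\<Sum>i\<in>{1..m}. \<Sum>j\<in>{1..n}. c i j * x i * y j)"
    using assms unfolding bilinear_form_def by blast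
  show ?thesis
    unfolding bilinear_form_def b c
    by (intro exI[of _ "\<lambda>i j. b i j + c i j"]) (simp add: sum.distrib distrib_right)
qed

lemma bilinear_form_scale:
  assumes "bilinear_form m n B"
  shows "bilinear_form m n (\<lambda>x y. a * B x y)"
proof -
  obtain b :: "nat \<Rightarrow> nat \<Rightarrow> real"
    where b: "\<And>x y. B x y = (\<Sum>i\<in>{1..m}. \<Sum>j\<in>{1..n}. b i j * x i * y j)"
    using assms unfolding bilinear_form_def by blast
  show ?thesis
    unfolding bilinear_form_def b
    by (intro exI[of _ "\<lambda>i j. a * b i j"]) (simp add: sum_distrib_left mult.assoc)
qed

text \<open>Lets a representation be given as an explicit list, so that its length bounds the SOS
  rank.\<close>

lemma sum_of_bilinear_squares_list:
  assumes "\<And>B. B \<in> set Bs \<Longrightarrow> bilinear_form m n B"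
    and "\<And>x y. P x y = (\<Sum>B\<leftarrow>Bs. (B x y)\<^sup>2)"
  shows "sum_of_bilinear_squares m n P (length Bs)"
  unfolding sum_of_bilinear_squares_def
  using assms
  by (intro exI[of _ "\<lambda>t. Bs ! t"]) (simp add: sum_list_sum_nth atLeast0LessThan)

lemma sos_rank_le: "sum_of_bilinear_squares m n P r \<Longrightarrow> sos_rank m n P \<le> r"
  unfolding sos_rank_def by (rule Least_le)

lemma opposite_cells_nondegenerate:
  assumes "i \<noteq> k" "j \<noteq> l"
  shows "opposite_cells {(i, j), (k, l)} = {(i, l), (k, j)}"
  using assms unfolding opposite_cells_def by auto

text \<open>A cycle is a nonempty walk, and every arc of a walk belongs to the digraph.\<close>

lemma cond_W2_if_no_arcs:
  assumes "arcs (dependency_graph E1 E2) = {}"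
  shows "cond_W2 E1 E2"
  using assms
  unfolding cond_W2_def pre_digraph.cycle_def pre_digraph.awalk_def by auto

theorem proposition20:
  fixes E1 :: "cell set" and E2 :: "cell set set"
  assumes "E1 = {(1,1), (1,2), (2,1), (2,3), (3,2), (3,3), (4,1), (5,2)}"
    and "E2 = {{(2,2), (3,1)}, {(4,2), (5,3)}}"
  shows "augmented_bipartite_graph 5 3 E1 E2
    \<and> (\<forall>x y. assoc_form E1 E2 x y =
          (\<Sum>(i, j)\<in>E1. (x i)\<^sup>2 * (y j)\<^sup>2) + (x 2 * y 2 + x 3 * y 1)\<^sup>2 + (x 4 * y 2 + x 5 * y 3)\<^sup>2)
    \<and> sos_rank 5 3 (assoc_form E1 E2) \<le> 9
    \<and> (9::nat) < 10 \<and> 10 = card E1 + card E2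
    \<and> \<not> irreducible_graph 5 3 E1 E2
    \<and> cond_S E1 E2 \<and> cond_W1 E1 \<and> cond_W2 E1 E2 \<and> cond_W3 E1 E2 \<and> \<not> cond_W2' E1 E2
    \<and> \<not> (\<forall>m n F1 F2. augmented_bipartite_graph m n F1 F2 \<and>
            cond_S F1 F2 \<and> cond_W1 F1 \<and> cond_W2 F1 F2 \<and> cond_W3 F1 F2
          \<longrightarrow> irreducible_graph m n F1 F2)"
proof -
  let ?e = "{(2,2), (3,1)} :: cell set" and ?f = "{(4,2), (5,3)} :: cell set"
  \<comment> \<open>Needed to split the sum over \<open>E2\<close> into two squares and to count
    \<open>E2\<close> as two elements.\<close>
  have ne: "?e \<noteq> ?f"
    by (simp add: doubleton_eq_iff)
  have occ: "occupied E1 E2 = {(1,1), (1,2), (2,1), (2,2), (2,3), (3,1), (3,2), (3,3),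
      (4,1), (4,2), (5,2), (5,3)}"
    unfolding assms occupied_def by auto
  have opp: "opposite_cells ?e = {(2,1), (3,2)}" "opposite_cells ?f = {(4,3), (5,2)}"
    by (simp_all add: opposite_cells_nondegenerate)
  have graph: "augmented_bipartite_graph 5 3 E1 E2"
    unfolding augmented_bipartite_graph_def assms by simp
  have form: "assoc_form E1 E2 x y =
      (\<Sum>(i, j)\<in>E1. (x i)\<^sup>2 * (y j)\<^sup>2) + (x 2 * y 2 + x 3 * y 1)\<^sup>2 + (x 4 * y 2 + x 5 * y 3)\<^sup>2"
    for x y
    unfolding assoc_form_def assms(2) using ne by simp
  define s :: real where "s = sqrt 3 / 2"
  have s: "s\<^sup>2 = 3 / 4"
    by (simp add: s_def power_divide)
  \<comment> \<open>The first five entries are the squares that stay unchanged; the last four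
    replace the five on rows 2 and 3. Writing \<open>1 / 2 * _\<close> and
    \<open>+ (- s) * _\<close> makes every entry a sum of scaled monomials, as the closure lemmas
    expect.\<close>
  define Bs :: "form list" where "Bs =
    [\<lambda>x y. x 1 * y 1, \<lambda>x y. x 1 * y 2, \<lambda>x y. x 4 * y 1, \<lambda>x y. x 5 * y 2,
     \<lambda>x y. x 4 * y 2 + x 5 * y 3,
     \<lambda>x y. x 2 * y 1 + 1 / 2 * (x 3 * y 2), \<lambda>x y. x 3 * y 1 + 1 / 2 * (x 2 * y 2),
     \<lambda>x y. x 2 * y 3 + (- s) * (x 3 * y 2), \<lambda>x y. x 3 * y 3 + s * (x 2 * y 2)]"
  have "sum_of_bilinear_squares 5 3 (assoc_form E1 E2) (length Bs)"
  proof (rule sum_of_bilinear_squares_list)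
    show "bilinear_form 5 3 B" if "B \<in> set Bs" for B
      using that unfolding Bs_def list.set insert_iff empty_iff
      by (elim disjE FalseE; hypsubst;
          intro bilinear_form_add bilinear_form_scale bilinear_form_monomial; simp)
    \<comment> \<open>The letters stand for the six monomials on rows 2 and 3. Of their product
      structure only two vanishing 2x2 minors of the rank-one matrix \<open>x i * y j\<close> enter:
      columns 1, 2 give \<open>a * b = c * d\<close>, columns 3, 2 give
      \<open>p * b = q * d\<close>.\<close>
    have four_squares: "(a + b / 2)\<^sup>2 + (c + d / 2)\<^sup>2 + (p - s * b)\<^sup>2 + (q + s * d)\<^sup>2
        = a\<^sup>2 + b\<^sup>2 + p\<^sup>2 + q\<^sup>2 + (d + c)\<^sup>2" if "a * b = c * d" "p * b = q * d" for a b c d p q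
    proof -
      have "(a + b / 2)\<^sup>2 + (c + d / 2)\<^sup>2 + (p - s * b)\<^sup>2 + (q + s * d)\<^sup>2
          = a\<^sup>2 + b\<^sup>2 / 4 + a * b + c\<^sup>2 + d\<^sup>2 / 4 + c * d + p\<^sup>2 + q\<^sup>2
            + s\<^sup>2 * (b\<^sup>2 + d\<^sup>2) + 2 * s * (q * d - p * b)"
        by (simp add: power2_eq_square algebra_simps)
      \<comment> \<open>The opposite signs of \<open>s\<close> in the last two squares make their
        cross terms cancel, while \<open>a * b + c * d\<close> becomes the mixed term
        \<open>2 * c * d\<close>.\<close>
      also have "q * d - p * b = 0"
        using that by simp
      finally show ?thesis
        using that by (simp add: s power2_sum field_simps)
    qed
    show "assoc_form E1 E2 x y = (\<Sum>B\<leftarrow>Bs. (B x y)\<^sup>2)" for x y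
      using four_squares[of "x 2 * y 1" "x 3 * y 2" "x 3 * y 1" "x 2 * y 2" "x 2 * y 3" "x 3 * y 3"]
      unfolding form unfolding assms(1) Bs_def by (simp add: power_mult_distrib)
  qed
  then have rank: "sos_rank 5 3 (assoc_form E1 E2) \<le> 9"
    using sos_rank_le by (fastforce simp: Bs_def)
  have card: "card E1 + card E2 = 10"
    unfolding assms using ne by simp
  have irr: "\<not> irreducible_graph 5 3 E1 E2"
    using rank card unfolding irreducible_graph_def by simp
  have S: "cond_S E1 E2"
    unfolding cond_S_def assms by simp
  have W1: "cond_W1 E1"
  proof -
    \<comment> \<open>Two diagonal cells determine a 4-cycle; ranging over cells of
      \<open>E1\<close> instead of indices leaves a finite check.\<close>
    have "\<forall>c\<in>E1. \<forall>d\<in>E1. fst c \<noteq> fst d \<longrightarrow> snd c \<noteq> snd d \<longrightarrow>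
        (fst c, snd d) \<notin> E1 \<or> (fst d, snd c) \<notin> E1"
      unfolding assms(1) by simp
    then show ?thesis
      unfolding cond_W1_def by fastforce
  qed
  have W2: "cond_W2 E1 E2"
  proof (rule cond_W2_if_no_arcs)
    \<comment> \<open>The opposite cells of \<open>?e\<close> are occupied, but by 1-edges, so no
      2-edge has a half there; \<open>?f\<close> has the unoccupied opposite cell (4,3).\<close>
    have "\<forall>e\<in>E2. \<forall>f\<in>E2. opposite_cells e \<subseteq> occupied E1 E2 \<longrightarrow>
        f \<inter> opposite_cells e = {}"
      unfolding occ unfolding assms(2) using opp by simp
    then show "arcs (dependency_graph E1 E2) = {}"
      unfolding dependency_graph_def by fastforce
  qed
  \<comment> \<open>With three columns, an edge vertex-disjoint from \<open>?e\<close> or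
    \<open>?f\<close> lies in the one column left over. For \<open>?e\<close> this is column 3,
    whose 1-edges meet its rows; for \<open>?f\<close> only (1,1) and (2,1) qualify, and then (5,1)
    is an unoccupied opposite cell.\<close>
  have W3: "cond_W3 E1 E2"
    unfolding cond_W3_def occ
    by (simp add: assms edges_def vertex_disjoint_def pair_opposite_cells_def)
  have W2': "\<not> cond_W2' E1 E2"
  proof -
    have "nondegenerate ?e"
      unfolding nondegenerate_def by (intro exI conjI) (rule refl, simp_all)
    moreover have "?e \<in> E2" "opposite_cells ?e \<subseteq> E1"
      unfolding opp by (simp_all add: assms)
    ultimately show ?thesis
      unfolding cond_W2'_def by blast
  qed
  have "\<not> (\<forall>m n F1 F2. augmented_bipartite_graph m n F1 F2 \<and>
            cond_S F1 F2 \<and> cond_W1 F1 \<and> cond_W2 F1 F2 \<and> cond_W3 F1 F2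
          \<longrightarrow> irreducible_graph m n F1 F2)"
    using graph S W1 W2 W3 irr by blast
  moreover have "(9::nat) < 10"
    by simp
  ultimately show ?thesis
    by (intro conjI allI graph form rank card[symmetric] irr S W1 W2 W3 W2')
qed

end
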